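(* Consider an infinite horizon discounted cost partially observed Markov decision process (POMDP) with state space $\{1,\dots,X\}$, action space $\{1,\dots,U\}$, continuous or discrete valued observations, transition matrices $P(u)$, observation kernels $B(u)$, belief-dependent costs $C(\pi,u)$ and discount factor $\rho\in[0,1)$. Suppose: (C) for each action $u$, $C(\pi,u)$ is first order stochastically decreasing in $\pi$: $\pi_1\ge_s\pi_2$ implies $C(\pi_1,u)\le C(\pi_2,u)$; (F1) $B(u)$ is totally positive of order 2 (TP2) for each $u$; (F2) $P(u)$ is TP2 for each $u$. Then $Q(\pi,u)$ in Bellman's equation is MLR decreasing in $\pi$ for each $u$. As a result, the value function $V(\pi)$ is MLR decreasing in $\pi$; that is, $\pi_1\ge_r\pi_2$ implies $V(\pi_1)\le V(\pi_2)$.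
   Context: $\Pi(X)$ denotes the set of probability vectors in $\mathbb{R}^X$ (beliefs). $P_{ij}(u)=\mathbb P(x_{k+1}=j\mid x_k=i,u_k=u)$; $B_{xy}(u)=p(y\mid x,u)$ is a conditional pmf or pdf. The cost $C(\pi,u)$ accrued at each stage is not necessarily linear in $\pi$. The belief evolves via $T(\pi,y,u)=B_y(u)P'(u)\pi/\sigma(\pi,y,u)$, $\sigma(\pi,y,u)=\mathbf 1'B_y(u)P'(u)\pi$, $B_y(u)=\mathrm{diag}(B_{1y}(u),\dots,B_{Xy}(u))$. Objective: minimize $J_\mu(\pi_0)=\mathbb E_\mu\{\sum_{k\ge1}\rho^{k-1}C(\pi_k,\mu(\pi_k))\}$ over stationary policies $\mu:\Pi(X)\to\{1,\dots,U\}$. Bellman's equation: $V(\pi)=\min_u Q(\pi,u)$, $Q(\pi,u)=C(\pi,u)+\rho\sum_{y}V(T(\pi,y,u))\sigma(\pi,y,u)$ (sum replaced by integral for continuous observations). Orders: $p\ge_s q$ (first order dominance) means $\sum_{i\ge j}p(i)\ge\sum_{i\ge j}q(i)$ for all $j$. $\pi_1\ge_r\pi_2$ (monotone likelihood ratio, MLR, dominance) means $\pi_1(i)\pi_2(j)\le\pi_2(i)\pi_1(j)$ for all $i<j$. A function $\phi$ on $\Pi(X)$ is MLR decreasing if $\pi_1\ge_r\pi_2$ implies $\phi(\pi_1)\le\phi(\pi_2)$. A stochastic matrix/kernel is TP2 if all its second order minors are nonnegative. *)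

theory Defs
  imports "HOL-Analysis.Analysis"
begin

text \<open>
  States are indexed by a finite linearly ordered type \<open>'n\<close>, actions by a finite type \<open>'u\<close>.
  The observation space is a set of reals carrying a reference measure \<open>M\<close>: counting measure on
  a countable set (observation kernels are pmfs) or Lebesgue measure on a Borel set (observation
  kernels are pdfs).  Sums and integrals over observations are both integrals with respect to \<open>M\<close>.
\<close>

type_synonym 'n belief = "real ^ 'n"

definition beliefs :: "('n::finite) belief set" where
  "beliefs = {p. (\<forall>i. 0 \<le> p $ i) \<and> (\<Sum>i\<in>UNIV. p $ i) = 1}"

definition fosd_ge :: "('n::{finite,linorder}) belief \<Rightarrow> 'n belief \<Rightarrow> bool" where
  "fosd_ge p q \<longleftrightarrow> (\<forall>j. (\<Sum>i\<in>{j..}. p $ i) \<ge> (\<Sum>i\<in>{j..}. q $ i))"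

definition mlr_ge :: "('n::{finite,linorder}) belief \<Rightarrow> 'n belief \<Rightarrow> bool" where
  "mlr_ge p q \<longleftrightarrow> (\<forall>i j. i < j \<longrightarrow> p $ i * q $ j \<le> q $ i * p $ j)"

definition fosd_decreasing :: "(('n::{finite,linorder}) belief \<Rightarrow> real) \<Rightarrow> bool" where
  "fosd_decreasing f \<longleftrightarrow> (\<forall>p\<in>beliefs. \<forall>q\<in>beliefs. fosd_ge p q \<longrightarrow> f p \<le> f q)"

definition mlr_decreasing :: "(('n::{finite,linorder}) belief \<Rightarrow> real) \<Rightarrow> bool" where
  "mlr_decreasing f \<longleftrightarrow> (\<forall>p\<in>beliefs. \<forall>q\<in>beliefs. mlr_ge p q \<longrightarrow> f p \<le> f q)"

definition TP2_on :: "'a::linorder set \<Rightarrow> 'b::linorder set \<Rightarrow> ('a \<Rightarrow> 'b \<Rightarrow> real) \<Rightarrow> bool" where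
  "TP2_on A B K \<longleftrightarrow>
     (\<forall>i\<in>A. \<forall>i'\<in>A. \<forall>j\<in>B. \<forall>j'\<in>B. i < i' \<longrightarrow> j < j' \<longrightarrow>
        0 \<le> K i j * K i' j' - K i j' * K i' j)"

definition stochastic_matrix :: "real ^ 'n ^ 'n::finite \<Rightarrow> bool" where
  "stochastic_matrix A \<longleftrightarrow> (\<forall>i. row i A \<in> beliefs)"

definition observation_space :: "real measure \<Rightarrow> bool" where
  "observation_space M \<longleftrightarrow>
     (\<exists>Y. countable Y \<and> M = count_space Y) \<or>
     (\<exists>Y\<in>sets borel. M = restrict_space lborel Y)"

text \<open>An integral equal to 1 entails integrability, hence measurability, of the kernel.\<close>

definition observation_kernel :: "real measure \<Rightarrow> ('n \<Rightarrow> real \<Rightarrow> real) \<Rightarrow> bool" where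
  "observation_kernel M K \<longleftrightarrow>
     (\<forall>x. (\<forall>y\<in>space M. 0 \<le> K x y) \<and> (\<integral>y. K x y \<partial>M) = 1)"

definition obs_diag :: "('u \<Rightarrow> 'n \<Rightarrow> real \<Rightarrow> real) \<Rightarrow> real \<Rightarrow> 'u \<Rightarrow> real ^ 'n ^ 'n::finite" where
  "obs_diag B y u = (\<chi> i j. if i = j then B u i y else 0)"

definition unnormalized_update ::
  "('u \<Rightarrow> real ^ 'n ^ 'n) \<Rightarrow> ('u \<Rightarrow> 'n \<Rightarrow> real \<Rightarrow> real) \<Rightarrow> ('n::finite) belief \<Rightarrow> real \<Rightarrow> 'u
     \<Rightarrow> real ^ 'n" where
  "unnormalized_update P B \<pi> y u = obs_diag B y u *v (transpose (P u) *v \<pi>)"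

definition obs_density ::
  "('u \<Rightarrow> real ^ 'n ^ 'n) \<Rightarrow> ('u \<Rightarrow> 'n \<Rightarrow> real \<Rightarrow> real) \<Rightarrow> ('n::finite) belief \<Rightarrow> real \<Rightarrow> 'u
     \<Rightarrow> real" where
  "obs_density P B \<pi> y u = (\<Sum>i\<in>UNIV. unnormalized_update P B \<pi> y u $ i)"

text \<open>
  Where \<^const>\<open>obs_density\<close> vanishes the filter below is the zero vector, which is not a belief;
  every use of it under an integral carries the factor \<^const>\<open>obs_density\<close>.
\<close>

definition belief_update ::
  "('u \<Rightarrow> real ^ 'n ^ 'n) \<Rightarrow> ('u \<Rightarrow> 'n \<Rightarrow> real \<Rightarrow> real) \<Rightarrow> ('n::finite) belief \<Rightarrow> real \<Rightarrow> 'u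
     \<Rightarrow> 'n belief" where
  "belief_update P B \<pi> y u = unnormalized_update P B \<pi> y u /\<^sub>R obs_density P B \<pi> y u"

text \<open>
  The events on the belief space.  With countably many observations all expectations are sums,
  so every set of beliefs is an event and measurability with respect to \<open>belief_events\<close> is no
  restriction; otherwise the events are the Borel sets.
\<close>

definition belief_events :: "real measure \<Rightarrow> ('n::finite) belief measure" where
  "belief_events M =
     (if countable (space M) then count_space beliefs else restrict_space borel beliefs)"

definition policies :: "real measure \<Rightarrow> (('n::finite) belief \<Rightarrow> 'u) set" where
  "policies M = measurable (belief_events M) (count_space UNIV)"

text \<open>
  \<open>belief_expectation M P B \<mu> k f \<pi>\<close> is the expectation of \<open>f\<close> at the belief reached from \<open>\<pi>\<close>
  after \<open>k\<close> transitions under the stationary policy \<open>\<mu>\<close>, conditioning on the first observation.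
\<close>

primrec belief_expectation ::
  "real measure \<Rightarrow> ('u \<Rightarrow> real ^ 'n ^ 'n) \<Rightarrow> ('u \<Rightarrow> 'n \<Rightarrow> real \<Rightarrow> real) \<Rightarrow> ('n belief \<Rightarrow> 'u)
     \<Rightarrow> nat \<Rightarrow> ('n belief \<Rightarrow> real) \<Rightarrow> ('n::finite) belief \<Rightarrow> real" where
  "belief_expectation M P B \<mu> 0 f = f"
| "belief_expectation M P B \<mu> (Suc k) f =
     (\<lambda>\<pi>. \<integral>y. belief_expectation M P B \<mu> k f (belief_update P B \<pi> y (\<mu> \<pi>))
             * obs_density P B \<pi> y (\<mu> \<pi>) \<partial>M)"

text \<open>
  The cost of the initial belief has weight 1; this is the indexing of stages under which the
  optimal cost satisfies \<open>V \<pi> = min\<^sub>u Q \<pi> u\<close> with \<open>Q\<close> as below.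
\<close>

definition discounted_cost ::
  "real measure \<Rightarrow> ('u \<Rightarrow> real ^ 'n ^ 'n) \<Rightarrow> ('u \<Rightarrow> 'n \<Rightarrow> real \<Rightarrow> real) \<Rightarrow> ('n belief \<Rightarrow> 'u \<Rightarrow> real)
     \<Rightarrow> real \<Rightarrow> ('n belief \<Rightarrow> 'u) \<Rightarrow> ('n::finite) belief \<Rightarrow> real" where
  "discounted_cost M P B C \<rho> \<mu> \<pi> =
     (\<Sum>k. \<rho> ^ k * belief_expectation M P B \<mu> k (\<lambda>p. C p (\<mu> p)) \<pi>)"

definition value_function ::
  "real measure \<Rightarrow> ('u \<Rightarrow> real ^ 'n ^ 'n) \<Rightarrow> ('u \<Rightarrow> 'n \<Rightarrow> real \<Rightarrow> real) \<Rightarrow> ('n belief \<Rightarrow> 'u \<Rightarrow> real)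
     \<Rightarrow> real \<Rightarrow> ('n::finite) belief \<Rightarrow> real" where
  "value_function M P B C \<rho> \<pi> = (INF \<mu>\<in>policies M. discounted_cost M P B C \<rho> \<mu> \<pi>)"

definition Q_function ::
  "real measure \<Rightarrow> ('u \<Rightarrow> real ^ 'n ^ 'n) \<Rightarrow> ('u \<Rightarrow> 'n \<Rightarrow> real \<Rightarrow> real) \<Rightarrow> ('n belief \<Rightarrow> 'u \<Rightarrow> real)
     \<Rightarrow> real \<Rightarrow> ('n belief \<Rightarrow> real) \<Rightarrow> ('n::finite) belief \<Rightarrow> 'u \<Rightarrow> real" where
  "Q_function M P B C \<rho> V \<pi> u =
     C \<pi> u + \<rho> * (\<integral>y. V (belief_update P B \<pi> y u) * obs_density P B \<pi> y u \<partial>M)"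

definition bellman_equation ::
  "real measure \<Rightarrow> ('u::finite \<Rightarrow> real ^ 'n ^ 'n) \<Rightarrow> ('u \<Rightarrow> 'n \<Rightarrow> real \<Rightarrow> real)
     \<Rightarrow> ('n belief \<Rightarrow> 'u \<Rightarrow> real) \<Rightarrow> real \<Rightarrow> (('n::finite) belief \<Rightarrow> real) \<Rightarrow> bool" where
  "bellman_equation M P B C \<rho> V \<longleftrightarrow>
     (\<forall>\<pi>\<in>beliefs. V \<pi> = Min (range (Q_function M P B C \<rho> V \<pi>)))"

end

theory Submission
  imports Defs
begin

text \<open>
  The conditional expectation of an MLR decreasing function of the updated belief is again MLR
  decreasing in the current belief, so value iteration preserves monotonicity.  The cost is
  bounded, because the beliefs have a least and a greatest element for first order dominance, so
  value iteration is a contraction; its limit is a bounded measurable MLR decreasing solution of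
  Bellman's equation.  Telescoping this equation along a policy bounds the limit by the
  discounted cost of every policy, with equality for a greedy one, which is measurable since
  there are finitely many actions.  Hence the limit is the value function on beliefs.
\<close>

section \<open>Stochastic orders\<close>

text \<open>Bayesian updating with TP2 kernels preserves MLR dominance but in general not first
  order dominance, so the induction runs in the MLR order although the cost is monotone in the other
  one; MLR dominance being stronger, the cost hypothesis carries over. A further obstacle is that
  two ordered beliefs induce different observation laws: the larger belief shifts mass to higher
  observations, so monotonicity of the posterior at a fixed observation does not suffice. Finally,
  the value function is an infimum over policies, so Bellman's equation has to be proved, and for
  uncountably many observations this requires joint measurability of the filter and a measurable
  choice of action. All function identities are kept relative to \<open>beliefs\<close>: functions
  are arbitrary elsewhere, and the filter can return the zero vector.\<close>

text \<open>A Cauchy--Binet inequality for two by two minors; all order comparisons below are instances of it.\<close>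

lemma sum_mult_sum_minors_le:
  fixes x y s t :: "'n::{finite,linorder} \<Rightarrow> real"
  assumes xy: "\<And>k l. k < l \<Longrightarrow> x k * y l \<le> y k * x l"
    and st: "\<And>k l. k < l \<Longrightarrow> t k * s l \<le> s k * t l"
  shows "(\<Sum>k\<in>UNIV. s k * x k) * (\<Sum>k\<in>UNIV. t k * y k)
    \<le> (\<Sum>k\<in>UNIV. t k * x k) * (\<Sum>k\<in>UNIV. s k * y k)"
proof -
  \<comment> \<open>Adding the terms for (k,l) and (l,k) factors the sum into two minors of equal
    sign; the diagonal vanishes.\<close>
  define F where "F k l = x k * y l * (t k * s l - s k * t l)" for k l
  have "0 \<le> F k l + F l k" for k l
  proof -
    have F: "F k l + F l k = (y k * x l - x k * y l) * (s k * t l - t k * s l)"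
      by (simp add: F_def algebra_simps)
    consider "k < l" | "l < k" | "k = l" by (rule linorder_cases)
    then show ?thesis
    proof cases
      case 1
      then show ?thesis unfolding F using xy[OF 1] st[OF 1] by simp
    next
      case 2
      then show ?thesis unfolding F using xy[OF 2] st[OF 2]
        by (intro mult_nonpos_nonpos) (simp_all add: mult.commute)
    next
      case 3
      then show ?thesis unfolding F by simp
    qed
  qed
  then have "0 \<le> (\<Sum>k\<in>UNIV. \<Sum>l\<in>UNIV. F k l + F l k)"
    by (intro sum_nonneg)
  also have "\<dots> = 2 * (\<Sum>k\<in>UNIV. \<Sum>l\<in>UNIV. F k l)"
    using sum.swap[of F UNIV UNIV] by (simp add: sum.distrib)
  also have "(\<Sum>k\<in>UNIV. \<Sum>l\<in>UNIV. F k l)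
      = (\<Sum>k\<in>UNIV. t k * x k) * (\<Sum>k\<in>UNIV. s k * y k)
        - (\<Sum>k\<in>UNIV. s k * x k) * (\<Sum>k\<in>UNIV. t k * y k)"
    unfolding sum_product F_def sum_subtractf[symmetric]
    by (intro sum.cong refl) (simp add: algebra_simps)
  finally show ?thesis by simp
qed

text \<open>The minor inequality is applied with weights 1 and the indicator of an upper set, whose
  ratio is increasing; the total masses are 1 and drop out.\<close>

lemma mlr_ge_imp_fosd_ge:
  fixes p q :: "'n::{finite,linorder} belief"
  assumes "p \<in> beliefs" "q \<in> beliefs" "mlr_ge p q"
  shows "fosd_ge p q"
  unfolding fosd_ge_def
proof
  fix j :: 'n
  define t where "t k = (if j \<le> k then 1 else 0 :: real)" for k
  have t: "(\<Sum>k\<in>UNIV. t k * v $ k) = (\<Sum>k\<in>{j..}. v $ k)" for v :: "'n belief"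
  proof -
    have "(\<Sum>k\<in>UNIV. t k * v $ k) = (\<Sum>k\<in>UNIV. if k \<in> {j..} then v $ k else 0)"
      by (intro sum.cong) (auto simp: t_def)
    then show ?thesis by (simp only: sum.inter_restrict[symmetric] finite_UNIV Int_UNIV_left finite)
  qed
  have "(\<Sum>k\<in>UNIV. 1 * p $ k) * (\<Sum>k\<in>UNIV. t k * q $ k)
      \<le> (\<Sum>k\<in>UNIV. t k * p $ k) * (\<Sum>k\<in>UNIV. 1 * q $ k)"
    using assms(3) by (intro sum_mult_sum_minors_le) (auto simp: mlr_ge_def t_def)
  then show "(\<Sum>i\<in>{j..}. q $ i) \<le> (\<Sum>i\<in>{j..}. p $ i)"
    using assms(1,2) by (simp add: t beliefs_def)
qed

lemma axis_in_beliefs: "axis i 1 \<in> beliefs"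
  by (auto simp: beliefs_def axis_def)

lemma fosd_ge_axis_Max:
  fixes p :: "'n::{finite,linorder} belief"
  assumes "p \<in> beliefs"
  shows "fosd_ge (axis (Max UNIV) 1) p"
  unfolding fosd_ge_def
proof
  fix j :: 'n
  have "(\<Sum>i\<in>{j..}. p $ i) \<le> (\<Sum>i\<in>UNIV. p $ i)"
    using assms by (intro sum_mono2) (auto simp: beliefs_def)
  also have "\<dots> = (\<Sum>i\<in>{j..}. axis (Max UNIV) (1::real) $ i)"
    using assms by (simp add: beliefs_def axis_def)
  finally show "(\<Sum>i\<in>{j..}. p $ i) \<le> (\<Sum>i\<in>{j..}. axis (Max UNIV) 1 $ i)" .
qed

lemma fosd_ge_axis_Min:
  fixes p :: "'n::{finite,linorder} belief"
  assumes "p \<in> beliefs"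
  shows "fosd_ge p (axis (Min UNIV) 1)"
  unfolding fosd_ge_def
proof
  fix j :: 'n
  show "(\<Sum>i\<in>{j..}. axis (Min UNIV) 1 $ i) \<le> (\<Sum>i\<in>{j..}. p $ i)"
  proof (cases "j \<le> Min UNIV")
    case True
    then have "{j..} = UNIV" by (auto intro: order_trans[OF _ Min_le])
    then show ?thesis using assms by (simp add: beliefs_def axis_def)
  next
    case False
    then have "(\<Sum>i\<in>{j..}. axis (Min UNIV) (1::real) $ i) = 0"
      by (intro sum.neutral) (auto simp: axis_def)
    moreover have "0 \<le> (\<Sum>i\<in>{j..}. p $ i)"
      using assms by (intro sum_nonneg) (auto simp: beliefs_def)
    ultimately show ?thesis by simp
  qed
qed

lemma fosd_decreasing_bounded:
  fixes f :: "'n::{finite,linorder} belief \<Rightarrow> real"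
  assumes "fosd_decreasing f"
  shows "\<exists>K. \<forall>p\<in>beliefs. \<bar>f p\<bar> \<le> K"
proof (intro exI ballI)
  fix p :: "'n belief" assume p: "p \<in> beliefs"
  have "f (axis (Max UNIV) 1) \<le> f p"
    using assms p fosd_ge_axis_Max[OF p] axis_in_beliefs unfolding fosd_decreasing_def by blast
  moreover have "f p \<le> f (axis (Min UNIV) 1)"
    using assms p fosd_ge_axis_Min[OF p] axis_in_beliefs unfolding fosd_decreasing_def by blast
  ultimately show "\<bar>f p\<bar> \<le> \<bar>f (axis (Max UNIV) 1)\<bar> + \<bar>f (axis (Min UNIV) 1)\<bar>"
    by linarith
qed

lemma mlr_decreasing_Min:
  fixes F :: "'n::{finite,linorder} belief \<Rightarrow> 'u::finite \<Rightarrow> real"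
  assumes "\<And>u. mlr_decreasing (\<lambda>\<pi>. F \<pi> u)"
  shows "mlr_decreasing (\<lambda>\<pi>. Min (range (F \<pi>)))"
  unfolding mlr_decreasing_def
proof (intro ballI impI)
  fix p q :: "'n belief" assume pq: "p \<in> beliefs" "q \<in> beliefs" "mlr_ge p q"
  have "Min (range (F q)) \<in> range (F q)" by (intro Min_in) auto
  then obtain u where u: "Min (range (F q)) = F q u" by (rule rangeE)
  have "Min (range (F p)) \<le> F p u" by (intro Min_le) auto
  also have "\<dots> \<le> F q u" using assms[of u] pq by (auto simp: mlr_decreasing_def)
  finally show "Min (range (F p)) \<le> Min (range (F q))" by (simp add: u)
qed

lemma mlr_decreasing_add_mult:
  assumes "mlr_decreasing f" "mlr_decreasing g" "0 \<le> (c::real)"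
  shows "mlr_decreasing (\<lambda>\<pi>. f \<pi> + c * g \<pi>)"
  using assms unfolding mlr_decreasing_def by (intro ballI impI add_mono mult_left_mono) auto

lemma mlr_decreasing_cong:
  assumes "\<And>p. p \<in> beliefs \<Longrightarrow> f p = g p"
  shows "mlr_decreasing f \<longleftrightarrow> mlr_decreasing g"
  using assms unfolding mlr_decreasing_def by auto

text \<open>Taking minima is nonexpansive: evaluate at a minimizer of the other function, then
  exchange the roles. This reduces the contraction estimate to single actions.\<close>

lemma abs_Min_range_diff_le:
  fixes f g :: "'u::finite \<Rightarrow> real"
  assumes "\<And>u. \<bar>f u - g u\<bar> \<le> e"
  shows "\<bar>Min (range f) - Min (range g)\<bar> \<le> e"
proof -
  have *: "Min (range f) \<le> Min (range g) + e" if "\<And>u. \<bar>f u - g u\<bar> \<le> e" for f g :: "'u \<Rightarrow> real"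
  proof -
    have "Min (range g) \<in> range g" by (intro Min_in) auto
    then obtain u where u: "Min (range g) = g u" by (rule rangeE)
    have "Min (range f) \<le> f u" by (intro Min_le) auto
    then show ?thesis using that[of u] u by linarith
  qed
  show ?thesis using *[of f g] *[of g f] assms by (auto simp: abs_minus_commute abs_le_iff)
qed

section \<open>The filter and its expectation operator\<close>

lemma beliefs_borel: "(beliefs :: ('n::finite) belief set) \<in> sets borel"
proof -
  have "closed (beliefs :: 'n belief set)"
    unfolding beliefs_def
    by (intro closed_Collect_conj closed_Collect_all closed_Collect_le closed_Collect_eq
        continuous_intros)
  then show ?thesis by (rule borel_closed)
qed

lemma space_belief_events [simp]: "space (belief_events M) = beliefs"
  by (simp add: belief_events_def space_restrict_space)

locale belief_mdp =
  fixes M :: "real measure"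
    and P :: "'u::finite \<Rightarrow> real ^ ('n::{finite,linorder}) ^ ('n::{finite,linorder})"
    and B :: "'u \<Rightarrow> 'n::{finite,linorder} \<Rightarrow> real \<Rightarrow> real"
  assumes obs_space: "observation_space M"
    and stochastic: "\<And>u. stochastic_matrix (P u)"
    and kernel: "\<And>u. observation_kernel M (B u)"
begin

lemma kernel_nonneg: "y \<in> space M \<Longrightarrow> 0 \<le> B u i y"
  using kernel[of u] by (simp add: observation_kernel_def)

lemma kernel_integral: "(\<integral>y. B u i y \<partial>M) = 1"
  using kernel[of u] by (simp add: observation_kernel_def)

lemma kernel_integrable: "integrable M (B u i)"
  using kernel_integral[of u i] not_integrable_integral_eq by fastforce

lemma kernel_measurable [measurable]: "B u i \<in> borel_measurable M"
  using kernel_integrable by (rule borel_measurable_integrable)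

text \<open>The predicted belief \<open>transpose (P u) *v \<pi>\<close>, with the factors ordered
  as weight times belief to match the minor inequality.\<close>

lemma predicted_nth: "(\<pi> v* P u) $ j = (\<Sum>i\<in>UNIV. P u $ i $ j * \<pi> $ i)"
  by (simp add: vector_matrix_mult_def mult.commute)

lemma predicted_in_beliefs:
  assumes "\<pi> \<in> beliefs"
  shows "\<pi> v* P u \<in> beliefs"
proof -
  have P: "0 \<le> P u $ i $ j" "(\<Sum>j\<in>UNIV. P u $ i $ j) = 1" for i j
    using stochastic[of u] by (auto simp: stochastic_matrix_def beliefs_def row_def)
  have "(\<Sum>j\<in>UNIV. \<Sum>i\<in>UNIV. P u $ i $ j * \<pi> $ i) = (\<Sum>i\<in>UNIV. \<Sum>j\<in>UNIV. P u $ i $ j * \<pi> $ i)"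
    by (rule sum.swap)
  also have "\<dots> = 1"
    using assms by (simp add: sum_distrib_right[symmetric] P beliefs_def)
  finally show ?thesis
    using assms P by (auto simp: beliefs_def predicted_nth intro!: sum_nonneg mult_nonneg_nonneg)
qed

lemma unnormalized_update_nth:
  "unnormalized_update P B \<pi> y u $ i = B u i y * (\<pi> v* P u) $ i"
proof -
  have "unnormalized_update P B \<pi> y u $ i
      = (\<Sum>j\<in>UNIV. if i = j then B u i y * (\<pi> v* P u) $ j else 0)"
    unfolding unnormalized_update_def transpose_matrix_vector
    by (subst matrix_vector_mult_def)
      (simp add: obs_diag_def if_distrib[of "\<lambda>c. c * _"] cong: if_cong)
  then show ?thesis by simp
qed

lemma obs_density_eq:
  "obs_density P B \<pi> y u = (\<Sum>i\<in>UNIV. B u i y * (\<pi> v* P u) $ i)"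
  by (simp add: obs_density_def unnormalized_update_nth)

lemma belief_update_nth:
  "belief_update P B \<pi> y u $ i = B u i y * (\<pi> v* P u) $ i / obs_density P B \<pi> y u"
  by (simp add: belief_update_def unnormalized_update_nth divide_inverse mult.commute)

lemma obs_density_nonneg:
  assumes "\<pi> \<in> beliefs" "y \<in> space M"
  shows "0 \<le> obs_density P B \<pi> y u"
  unfolding obs_density_eq
  using predicted_in_beliefs[OF assms(1), of u] kernel_nonneg[OF assms(2)]
  by (auto simp: beliefs_def intro!: sum_nonneg mult_nonneg_nonneg)

lemma belief_update_in_beliefs:
  assumes "\<pi> \<in> beliefs" "y \<in> space M" "obs_density P B \<pi> y u \<noteq> 0"
  shows "belief_update P B \<pi> y u \<in> beliefs"
proof -
  have "(\<Sum>i\<in>UNIV. belief_update P B \<pi> y u $ i) = 1"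
    unfolding belief_update_nth sum_divide_distrib[symmetric] obs_density_eq[symmetric]
    using assms(3) by simp
  moreover have "0 \<le> belief_update P B \<pi> y u $ i" for i
    using obs_density_nonneg[OF assms(1,2), of u] predicted_in_beliefs[OF assms(1), of u]
      kernel_nonneg[OF assms(2)] unfolding belief_update_nth
    by (auto simp: beliefs_def)
  ultimately show ?thesis by (auto simp: beliefs_def)
qed

lemma obs_density_integrable: "integrable M (\<lambda>y. obs_density P B \<pi> y u)"
  unfolding obs_density_eq by (intro Bochner_Integration.integrable_sum integrable_mult_left kernel_integrable)

lemma obs_density_integral:
  assumes "\<pi> \<in> beliefs"
  shows "(\<integral>y. obs_density P B \<pi> y u \<partial>M) = 1"
  using predicted_in_beliefs[OF assms, of u] unfolding obs_density_eq
  by (subst Bochner_Integration.integral_sum)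
    (auto simp: kernel_integrable kernel_integral beliefs_def intro!: integrable_mult_left)

section \<open>Measurability of the filter\<close>

lemma sigma_finite_obs: "sigma_finite_measure M"
  using obs_space unfolding observation_space_def
  by (auto intro: sigma_finite_measure_count_space_countable
      sigma_finite_measure_restrict_space[OF lborel.sigma_finite_measure_axioms])

text \<open>\<open>belief_events\<close> branches on countability of the observations,
  \<open>observation_space\<close> on the kind of reference measure. The branches fit together
  because Lebesgue measure on a countable set is null, so no kernel could integrate to 1
  there.\<close>

lemma observation_cases:
  obtains (discrete) Y where "countable Y" "M = count_space Y"
      "(belief_events M :: 'n belief measure) = count_space beliefs"
  | (continuous) "(belief_events M :: 'n belief measure) = restrict_space borel beliefs"
proof (cases "countable (space M)")
  case True
  have False if Y: "Y \<in> sets borel" "M = restrict_space lborel Y" for Y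
  proof -
    have "countable Y" using True Y by (simp add: space_restrict_space)
    then have "emeasure lborel Y = 0" by (rule emeasure_lborel_countable)
    then have "emeasure M (space M) = 0"
      using Y by (simp add: space_restrict_space emeasure_restrict_space)
    then have "AE y in M. B u i y = 0" for u i
      by (intro AE_I[of _ _ "space M"]) auto
    then have "(\<integral>y. B u i y \<partial>M) = 0" for u i by (rule integral_eq_zero_AE)
    then show False using kernel_integral by simp
  qed
  then show thesis
    using obs_space True discrete unfolding observation_space_def belief_events_def by auto
next
  case False
  then show thesis using continuous by (simp add: belief_events_def)
qed

lemma update_measurable_pair:
  assumes f: "f \<in> borel_measurable (belief_events M)"
  shows "(\<lambda>(\<pi>, y). f (belief_update P B \<pi> y u) * obs_density P B \<pi> y u)
    \<in> borel_measurable (belief_events M \<Otimes>\<^sub>M M)"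
proof (cases rule: observation_cases)
  case (discrete Y)
  \<comment> \<open>With all sets of beliefs as events each slice in \<open>y\<close> is measurable,
    and countably many slices are glued.\<close>
  let ?g = "\<lambda>y x. f (belief_update P B (fst x) y u) * obs_density P B (fst x) y u"
  have "(\<lambda>x. ?g (snd x) x) \<in> borel_measurable (belief_events M \<Otimes>\<^sub>M M)"
  proof (rule measurable_compose_countable'[where f = ?g and I = Y])
    have "(\<lambda>\<pi>. f (belief_update P B \<pi> y u) * obs_density P B \<pi> y u)
        \<in> borel_measurable (belief_events M)" for y
      by (simp add: discrete(3))
    then show "?g y \<in> borel_measurable (belief_events M \<Otimes>\<^sub>M M)" for y
      by (rule measurable_compose[OF measurable_fst])
    show "snd \<in> measurable (belief_events M \<Otimes>\<^sub>M M) (count_space Y)"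
      unfolding discrete(2) by (rule measurable_snd)
  qed (rule discrete(1))
  then show ?thesis by (simp add: case_prod_beta')
next
  case continuous
  \<comment> \<open>The filter leaves \<open>beliefs\<close> where the density vanishes, while
    \<open>f\<close> is measurable only on \<open>beliefs\<close>. Cutting \<open>f\<close> off
    gives a Borel function on the whole space, and the density factor hides the change.\<close>
  define h where "h p = indicator beliefs p *\<^sub>R f p" for p
  have h [measurable]: "h \<in> borel_measurable borel"
    using f beliefs_borel unfolding continuous h_def
    by (subst (asm) borel_measurable_restrict_space_iff) auto
  have [measurable]: "(\<lambda>x. B u i (snd x)) \<in> borel_measurable (belief_events M \<Otimes>\<^sub>M M)" for i
    by (rule measurable_compose[OF measurable_snd kernel_measurable])
  have "(\<lambda>\<pi> :: 'n belief. \<pi> $ i) \<in> borel_measurable (belief_events M)" for i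
    unfolding continuous
    by (intro measurable_restrict_space1 borel_measurable_continuous_onI continuous_intros)
  then have [measurable]: "(\<lambda>x. (fst x :: 'n belief) $ i) \<in> borel_measurable (belief_events M \<Otimes>\<^sub>M M)" for i
    by (rule measurable_compose[OF measurable_fst])
  have [measurable]: "(\<lambda>x. obs_density P B (fst x) (snd x) u)
      \<in> borel_measurable (belief_events M \<Otimes>\<^sub>M M)"
    unfolding obs_density_eq predicted_nth by measurable
  have "(\<lambda>x. \<Sum>i\<in>UNIV. (belief_update P B (fst x) (snd x) u $ i) *\<^sub>R axis i 1 :: 'n belief)
      \<in> borel_measurable (belief_events M \<Otimes>\<^sub>M M)"
    unfolding belief_update_nth predicted_nth by measurable
  then have [measurable]: "(\<lambda>x. belief_update P B (fst x) (snd x) u)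
      \<in> borel_measurable (belief_events M \<Otimes>\<^sub>M M)"
    using basis_expansion[of "belief_update P B _ _ u"] by (simp add: scalar_mult_eq_scaleR)
  have "(\<lambda>x. h (belief_update P B (fst x) (snd x) u) * obs_density P B (fst x) (snd x) u)
      \<in> borel_measurable (belief_events M \<Otimes>\<^sub>M M)"
    by measurable
  then show ?thesis
  proof (rule measurable_cong[THEN iffD1, rotated])
    fix x :: "'n belief \<times> real" assume "x \<in> space (belief_events M \<Otimes>\<^sub>M M)"
    then have "fst x \<in> beliefs" "snd x \<in> space M" by (auto simp: space_pair_measure)
    then show "h (belief_update P B (fst x) (snd x) u) * obs_density P B (fst x) (snd x) u
        = (case x of (\<pi>, y) \<Rightarrow> f (belief_update P B \<pi> y u) * obs_density P B \<pi> y u)"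
      using belief_update_in_beliefs[of "fst x" "snd x" u]
      by (cases "obs_density P B (fst x) (snd x) u = 0") (auto simp: h_def case_prod_beta')
  qed
qed

section \<open>The transition operator of the belief chain on bounded measurable functions\<close>

definition expect_next :: "'u \<Rightarrow> ('n belief \<Rightarrow> real) \<Rightarrow> 'n belief \<Rightarrow> real" where
  "expect_next u f \<pi> = (\<integral>y. f (belief_update P B \<pi> y u) * obs_density P B \<pi> y u \<partial>M)"

definition bounded_measurable :: "('n belief \<Rightarrow> real) \<Rightarrow> bool" where
  "bounded_measurable f \<longleftrightarrow>
    f \<in> borel_measurable (belief_events M) \<and> (\<exists>K. \<forall>p\<in>beliefs. \<bar>f p\<bar> \<le> K)"

lemma bounded_measurableI:
  assumes "f \<in> borel_measurable (belief_events M)" "\<And>p. p \<in> beliefs \<Longrightarrow> \<bar>f p\<bar> \<le> K"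
  shows "bounded_measurable f"
  using assms unfolding bounded_measurable_def by blast

lemma bounded_measurable_const: "bounded_measurable (\<lambda>_. c)"
  by (rule bounded_measurableI[where K = "\<bar>c\<bar>"]) auto

lemma bounded_measurable_add_mult:
  assumes "bounded_measurable f" "bounded_measurable g"
  shows "bounded_measurable (\<lambda>p. f p + c * g p)"
proof -
  obtain K L where *: "\<forall>p\<in>beliefs. \<bar>f p\<bar> \<le> K" "\<forall>p\<in>beliefs. \<bar>g p\<bar> \<le> L"
    and [measurable]: "f \<in> borel_measurable (belief_events M)" "g \<in> borel_measurable (belief_events M)"
    using assms unfolding bounded_measurable_def by blast
  show ?thesis
  proof (rule bounded_measurableI)
    fix p :: "'n belief" assume "p \<in> beliefs"
    then have "\<bar>f p\<bar> \<le> K" "\<bar>c * g p\<bar> \<le> \<bar>c\<bar> * L"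
      using * by (auto simp: abs_mult intro: mult_left_mono)
    then show "\<bar>f p + c * g p\<bar> \<le> K + \<bar>c\<bar> * L" by linarith
  qed measurable
qed

text \<open>Finiteness of the action type enters twice: measurable pieces are glued along \<mu>, and
  the bounds for single actions have a maximum.\<close>

lemma bounded_measurable_policy:
  fixes F :: "'u \<Rightarrow> 'n belief \<Rightarrow> real"
  assumes "\<And>u. bounded_measurable (F u)" "\<mu> \<in> policies M"
  shows "bounded_measurable (\<lambda>p. F (\<mu> p) p)"
proof -
  have "\<exists>K. \<forall>p\<in>beliefs. \<bar>F u p\<bar> \<le> K" for u
    using assms(1) unfolding bounded_measurable_def by blast
  then obtain K where K: "\<And>u p. p \<in> beliefs \<Longrightarrow> \<bar>F u p\<bar> \<le> K u" by metis
  show ?thesis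
  proof (rule bounded_measurableI)
    show "(\<lambda>p. F (\<mu> p) p) \<in> borel_measurable (belief_events M)"
    proof (rule measurable_compose_countable'[where f = F and I = UNIV])
      show "\<And>u. F u \<in> borel_measurable (belief_events M)"
        using assms(1) by (simp add: bounded_measurable_def)
      show "\<mu> \<in> measurable (belief_events M) (count_space UNIV)"
        using assms(2) by (simp add: policies_def)
    qed (rule countable_finite[OF finite])
    fix p :: "'n belief" assume "p \<in> beliefs"
    then have "\<bar>F (\<mu> p) p\<bar> \<le> K (\<mu> p)" by (rule K)
    also have "\<dots> \<le> Max (range K)" by (intro Max_ge) auto
    finally show "\<bar>F (\<mu> p) p\<bar> \<le> Max (range K)" .
  qed
qed

lemma integrable_update:
  assumes "bounded_measurable f" "\<pi> \<in> beliefs"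
  shows "integrable M (\<lambda>y. f (belief_update P B \<pi> y u) * obs_density P B \<pi> y u)"
proof -
  obtain K where K: "\<forall>p\<in>beliefs. \<bar>f p\<bar> \<le> K" and f: "f \<in> borel_measurable (belief_events M)"
    using assms unfolding bounded_measurable_def by blast
  show ?thesis
  proof (rule Bochner_Integration.integrable_bound)
    show "integrable M (\<lambda>y. K * obs_density P B \<pi> y u)"
      by (intro integrable_mult_right obs_density_integrable)
    show "(\<lambda>y. f (belief_update P B \<pi> y u) * obs_density P B \<pi> y u) \<in> borel_measurable M"
      using measurable_compose[OF measurable_Pair1' update_measurable_pair[OF f, of u], of \<pi>] assms(2)
      by simp
    have "\<bar>f (belief_update P B \<pi> y u)\<bar> * \<bar>obs_density P B \<pi> y u\<bar> \<le> \<bar>K\<bar> * \<bar>obs_density P B \<pi> y u\<bar>"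
      if "y \<in> space M" for y
      using K belief_update_in_beliefs[OF assms(2) that, of u]
      by (cases "obs_density P B \<pi> y u = 0") (auto intro!: mult_right_mono)
    then show "AE y in M. norm (f (belief_update P B \<pi> y u) * obs_density P B \<pi> y u)
        \<le> norm (K * obs_density P B \<pi> y u)"
      by (auto simp: abs_mult)
  qed
qed

lemma expect_next_add_mult:
  assumes "bounded_measurable f" "bounded_measurable g" "\<pi> \<in> beliefs"
  shows "expect_next u (\<lambda>p. f p + c * g p) \<pi> = expect_next u f \<pi> + c * expect_next u g \<pi>"
  using integrable_update[OF assms(1,3), of u] integrable_update[OF assms(2,3), of u]
  unfolding expect_next_def by (simp add: distrib_right mult.assoc)

lemma expect_next_const:
  assumes "\<pi> \<in> beliefs"
  shows "expect_next u (\<lambda>_. c) \<pi> = c"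
  using obs_density_integral[OF assms] unfolding expect_next_def by simp

lemma expect_next_mono:
  assumes "bounded_measurable f" "bounded_measurable g" "\<pi> \<in> beliefs"
    and "\<And>p. p \<in> beliefs \<Longrightarrow> f p \<le> g p"
  shows "expect_next u f \<pi> \<le> expect_next u g \<pi>"
  unfolding expect_next_def
proof (rule integral_mono)
  fix y assume y: "y \<in> space M"
  show "f (belief_update P B \<pi> y u) * obs_density P B \<pi> y u
      \<le> g (belief_update P B \<pi> y u) * obs_density P B \<pi> y u"
    using belief_update_in_beliefs[OF assms(3) y, of u] obs_density_nonneg[OF assms(3) y, of u] assms(4)
    by (cases "obs_density P B \<pi> y u = 0") (auto intro: mult_right_mono)
qed (use assms in \<open>auto intro: integrable_update\<close>)

lemma expect_next_cong:
  assumes "\<pi> \<in> beliefs" "\<And>p. p \<in> beliefs \<Longrightarrow> f p = g p"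
  shows "expect_next u f \<pi> = expect_next u g \<pi>"
  unfolding expect_next_def
proof (rule Bochner_Integration.integral_cong[OF refl])
  fix y assume y: "y \<in> space M"
  show "f (belief_update P B \<pi> y u) * obs_density P B \<pi> y u
      = g (belief_update P B \<pi> y u) * obs_density P B \<pi> y u"
    using belief_update_in_beliefs[OF assms(1) y, of u] assms(2)
    by (cases "obs_density P B \<pi> y u = 0") auto
qed

lemma expect_next_abs_diff_le:
  assumes "bounded_measurable f" "bounded_measurable g" "\<pi> \<in> beliefs"
    and "\<And>p. p \<in> beliefs \<Longrightarrow> \<bar>f p - g p\<bar> \<le> e"
  shows "\<bar>expect_next u f \<pi> - expect_next u g \<pi>\<bar> \<le> e"
proof -
  have *: "expect_next u f \<pi> \<le> expect_next u g \<pi> + e"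
    if bm: "bounded_measurable f" "bounded_measurable g" and "\<And>p. p \<in> beliefs \<Longrightarrow> \<bar>f p - g p\<bar> \<le> e"
    for f g
  proof -
    \<comment> \<open>The factor 1 gives the constant the shape of
      \<open>expect_next_add_mult\<close>; its expectation is then again \<open>e\<close>.\<close>
    have "expect_next u f \<pi> \<le> expect_next u (\<lambda>p. g p + e * 1) \<pi>"
      using that by (intro expect_next_mono bounded_measurable_add_mult bounded_measurable_const assms(3))
        (auto simp: abs_le_iff algebra_simps)
    also have "\<dots> = expect_next u g \<pi> + e * expect_next u (\<lambda>_. 1) \<pi>"
      by (rule expect_next_add_mult[OF bm(2) bounded_measurable_const assms(3)])
    finally show ?thesis using expect_next_const[OF assms(3)] by simp
  qed
  show ?thesis using *[of f g] *[of g f] assms by (auto simp: abs_minus_commute abs_le_iff)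
qed

lemma bounded_measurable_expect_next:
  assumes "bounded_measurable f"
  shows "bounded_measurable (expect_next u f)"
proof -
  obtain K where K: "\<forall>p\<in>beliefs. \<bar>f p\<bar> \<le> K" and f: "f \<in> borel_measurable (belief_events M)"
    using assms unfolding bounded_measurable_def by blast
  \<comment> \<open>Sigma-finiteness makes the integral of a jointly measurable function measurable
    in the remaining variable.\<close>
  interpret sigma_finite_measure M by (rule sigma_finite_obs)
  show ?thesis
  proof (rule bounded_measurableI)
    show "expect_next u f \<in> borel_measurable (belief_events M)"
      unfolding expect_next_def[abs_def]
      using update_measurable_pair[OF f] by (rule borel_measurable_lebesgue_integral)
    fix p :: "'n belief" assume p: "p \<in> beliefs"
    show "\<bar>expect_next u f p\<bar> \<le> K"
      using expect_next_abs_diff_le[OF assms bounded_measurable_const[of 0] p, of K u] K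
        expect_next_const[OF p, of u 0] by simp
  qed
qed

section \<open>Monotonicity of the expectation operator\<close>

text \<open>The weights in the minor inequality are two columns of \<open>P u\<close>; TP2 says that
  their ratio is monotone in the row.\<close>

lemma mlr_ge_predicted:
  assumes "mlr_ge p q" and F2: "TP2_on UNIV UNIV (\<lambda>i j. P u $ i $ j)"
  shows "mlr_ge (p v* P u) (q v* P u)"
  unfolding mlr_ge_def predicted_nth
proof (intro allI impI)
  fix i j :: 'n assume "i < j"
  then have "(\<Sum>k\<in>UNIV. P u $ k $ i * p $ k) * (\<Sum>k\<in>UNIV. P u $ k $ j * q $ k)
    \<le> (\<Sum>k\<in>UNIV. P u $ k $ j * p $ k) * (\<Sum>k\<in>UNIV. P u $ k $ i * q $ k)"
    using assms by (intro sum_mult_sum_minors_le) (auto simp: mlr_ge_def TP2_on_def)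
  then show "(\<Sum>k\<in>UNIV. P u $ k $ i * p $ k) * (\<Sum>k\<in>UNIV. P u $ k $ j * q $ k)
    \<le> (\<Sum>k\<in>UNIV. P u $ k $ i * q $ k) * (\<Sum>k\<in>UNIV. P u $ k $ j * p $ k)"
    by (simp add: mult.commute)
qed

text \<open>The case \<open>y = z\<close> is included because posteriors are also compared after one
  and the same observation.\<close>

lemma TP2_kernel_minor:
  assumes "TP2_on UNIV (space M) (B u)" "y \<in> space M" "z \<in> space M" "y \<le> z" "i \<le> j"
  shows "B u i z * B u j y \<le> B u i y * B u j z"
  using assms by (cases "i = j"; cases "y = z") (auto simp: TP2_on_def mult.commute)

text \<open>Likelihood ratios multiply, so the orders in the prior and in the observation combine.
  The normalizers form the same factor on both sides; if one vanishes, division by 0 makes both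
  sides 0.\<close>

lemma belief_update_mlr_ge:
  assumes p: "p \<in> beliefs" and q: "q \<in> beliefs" and y: "y \<in> space M" and z: "z \<in> space M"
    and "y \<le> z" and ab: "mlr_ge (p v* P u) (q v* P u)"
    and F1: "TP2_on UNIV (space M) (B u)"
  shows "mlr_ge (belief_update P B p z u) (belief_update P B q y u)"
  unfolding mlr_ge_def
proof (intro allI impI)
  fix i j :: 'n assume ij: "i < j"
  let ?a = "p v* P u" and ?b = "q v* P u"
  have "(B u i z * B u j y) * (?a $ i * ?b $ j) \<le> (B u i y * B u j z) * (?b $ i * ?a $ j)"
    using TP2_kernel_minor[OF F1 y z \<open>y \<le> z\<close>, of i j] ij ab predicted_in_beliefs[OF p, of u]
      predicted_in_beliefs[OF q, of u] kernel_nonneg[OF y] kernel_nonneg[OF z]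
    by - (rule mult_mono; auto simp: mlr_ge_def beliefs_def)
  then have "(B u i z * B u j y) * (?a $ i * ?b $ j) / (obs_density P B p z u * obs_density P B q y u)
      \<le> (B u i y * B u j z) * (?b $ i * ?a $ j) / (obs_density P B p z u * obs_density P B q y u)"
    using obs_density_nonneg[OF p z] obs_density_nonneg[OF q y] by (intro divide_right_mono) auto
  then show "belief_update P B p z u $ i * belief_update P B q y u $ j
      \<le> belief_update P B q y u $ i * belief_update P B p z u $ j"
    unfolding belief_update_nth by (simp add: ac_simps)
qed

text \<open>The observation laws of the two beliefs are themselves MLR ordered: here the weights in
  the minor inequality are the likelihoods of \<open>y\<close> and \<open>z\<close>.\<close>

lemma obs_density_cross_le:
  assumes "y \<in> space M" "z \<in> space M" "y \<le> z"
    and "mlr_ge (p v* P u) (q v* P u)"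
    and "TP2_on UNIV (space M) (B u)"
  shows "obs_density P B p y u * obs_density P B q z u \<le> obs_density P B p z u * obs_density P B q y u"
  unfolding obs_density_eq using assms TP2_kernel_minor[OF assms(5,1,2,3)]
  by (intro sum_mult_sum_minors_le) (auto simp: mlr_ge_def)

text \<open>
  With \<open>\<sigma>\<close> the observation densities and \<open>g = f (belief_update \<dots>) \<sigma>\<close> for the two beliefs, the
  difference of the two expectations is half the iterated integral of the symmetric function \<open>H\<close>
  below, which is pointwise nonnegative.  Working with pairs of observations avoids the usual
  intermediate quantity \<open>\<integral> f (T q y) \<sigma>\<^sub>p y\<close>, which is meaningless where \<open>\<sigma>\<^sub>q\<close> vanishes but
  \<open>\<sigma>\<^sub>p\<close> does not.
\<close>

lemma expect_next_mlr_decreasing: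
  assumes f: "bounded_measurable f" and dec: "mlr_decreasing f"
    and F1: "TP2_on UNIV (space M) (B u)" and F2: "TP2_on UNIV UNIV (\<lambda>i j. P u $ i $ j)"
  shows "mlr_decreasing (expect_next u f)"
  unfolding mlr_decreasing_def
proof (intro ballI impI)
  fix p q :: "'n belief"
  assume p: "p \<in> beliefs" and q: "q \<in> beliefs" and pq: "mlr_ge p q"
  note ab = mlr_ge_predicted[OF pq F2]
  define T S where "T r y = belief_update P B r y u" and "S r y = obs_density P B r y u" for r y
  define g where "g r y = f (T r y) * S r y" for r y
  define H where "H y z = g q z * S p y - g p y * S q z + g q y * S p z - g p z * S q y" for y z
  have S0: "0 \<le> S r y" if "r \<in> beliefs" "y \<in> space M" for r y
    using obs_density_nonneg that by (simp add: S_def)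
  have T: "T r y \<in> beliefs" if "r \<in> beliefs" "y \<in> space M" "S r y \<noteq> 0" for r y
    using belief_update_in_beliefs that by (simp add: S_def T_def)
  have step: "f (T r z) \<le> f (T s y)"
    if "mlr_ge (r v* P u) (s v* P u)" "y \<le> z" "r \<in> beliefs" "s \<in> beliefs"
      "y \<in> space M" "z \<in> space M" "S r z \<noteq> 0" "S s y \<noteq> 0" for r s y z
    using dec belief_update_mlr_ge[of r s y z u] T that F1 unfolding mlr_decreasing_def T_def
    by (auto simp: S_def T_def)
  have H_le: "0 \<le> H y z" if y: "y \<in> space M" and z: "z \<in> space M" and yz: "y \<le> z" for y z
  proof -
    define A D where "A = S p z * S q y" and "D = S p y * S q z"
    have D0: "0 \<le> D" and A0: "0 \<le> A" using S0 p q y z by (auto simp: A_def D_def)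
    have DA: "D \<le> A"
      using obs_density_cross_le[OF y z yz ab F1] by (simp add: A_def D_def S_def)
    \<comment> \<open>Only the bracket of \<open>A\<close>, where \<open>p\<close> has the larger
      observation, has a definite sign. Lowering its weight from \<open>A\<close> to
      \<open>D\<close> and regrouping leaves comparisons of \<open>p\<close> and \<open>q\<close> at
      equal observations.\<close>
    have eq: "H y z = A * (f (T q y) - f (T p z)) + D * (f (T q z) - f (T p y))"
      by (simp add: H_def g_def A_def D_def algebra_simps)
    have A: "0 \<le> f (T q y) - f (T p z)" if "A \<noteq> 0"
      using step[OF ab yz p q y z] that by (auto simp: A_def)
    show ?thesis
    proof (cases "D = 0")
      case True
      then show ?thesis using A A0 by (cases "A = 0") (auto simp: eq)
    next
      case False
      \<comment> \<open>Now all four densities are nonzero, so all four posteriors are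
        beliefs.\<close>
      then have "A \<noteq> 0" using DA D0 by auto
      then have "D * (f (T q y) - f (T p z)) \<le> A * (f (T q y) - f (T p z))"
        using DA A by (intro mult_right_mono)
      moreover have "f (T p y) \<le> f (T q y)" "f (T p z) \<le> f (T q z)"
        using step[OF ab order_refl p q y y] step[OF ab order_refl p q z z] \<open>A \<noteq> 0\<close> False
        by (auto simp: A_def D_def)
      then have "0 \<le> D * ((f (T q y) - f (T p y)) + (f (T q z) - f (T p z)))"
        using D0 by simp
      ultimately show ?thesis unfolding eq by (simp add: algebra_simps)
    qed
  qed
  have H: "0 \<le> H y z" if "y \<in> space M" "z \<in> space M" for y z
    using H_le[of y z] H_le[of z y] that by (cases "y \<le> z") (auto simp: H_def)
  have S: "integrable M (S r)" "(\<integral>y. S r y \<partial>M) = 1" if "r \<in> beliefs" for r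
    using obs_density_integrable obs_density_integral that by (auto simp: S_def[abs_def])
  have g: "integrable M (g r)" if "r \<in> beliefs" for r
    using integrable_update[OF f that] by (simp add: g_def[abs_def] S_def T_def)
  let ?I = "\<lambda>r. \<integral>y. g r y \<partial>M"
  \<comment> \<open>The densities integrate to 1, so the inner integral is explicit and no exchange
    of integrals is needed.\<close>
  have inner: "(\<integral>z. H y z \<partial>M) = ?I q * S p y - g p y + g q y - ?I p * S q y" for y
    unfolding H_def using S p q g by simp
  have "0 \<le> (\<integral>y. \<integral>z. H y z \<partial>M \<partial>M)"
    using H by (intro integral_nonneg_AE AE_I2) (auto intro!: integral_nonneg_AE)
  also have "\<dots> = 2 * (?I q - ?I p)"
    unfolding inner using S p q g by simp
  finally show "expect_next u f p \<le> expect_next u f q"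
    by (simp add: expect_next_def g_def S_def T_def)
qed

section \<open>Costs along a policy\<close>

lemma belief_expectation_Suc:
  "belief_expectation M P B \<mu> (Suc k) f \<pi> = expect_next (\<mu> \<pi>) (belief_expectation M P B \<mu> k f) \<pi>"
  by (simp add: expect_next_def)

text \<open>The recursion conditions on the first transition; telescoping needs the last one split
  off instead.\<close>

lemma belief_expectation_Suc_right:
  "belief_expectation M P B \<mu> (Suc k) f = belief_expectation M P B \<mu> k (\<lambda>p. expect_next (\<mu> p) f p)"
proof (induction k)
  case 0
  show ?case by (simp add: expect_next_def)
next
  case (Suc k)
  show ?case
    unfolding fun_eq_iff belief_expectation_Suc[of _ "Suc k"] Suc.IH belief_expectation_Suc by simp
qed

lemma bounded_measurable_belief_expectation:
  assumes "bounded_measurable f" "\<mu> \<in> policies M"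
  shows "bounded_measurable (belief_expectation M P B \<mu> k f)"
proof (induction k)
  case (Suc k)
  then have "bounded_measurable (\<lambda>p. expect_next (\<mu> p) (belief_expectation M P B \<mu> k f) p)"
    by (rule bounded_measurable_policy[OF bounded_measurable_expect_next assms(2)])
  then show ?case by (simp add: expect_next_def)
qed (use assms in simp)

lemma belief_expectation_mono:
  assumes "bounded_measurable f" "bounded_measurable g" "\<mu> \<in> policies M"
    and "\<And>p. p \<in> beliefs \<Longrightarrow> f p \<le> g p" and "\<pi> \<in> beliefs"
  shows "belief_expectation M P B \<mu> k f \<pi> \<le> belief_expectation M P B \<mu> k g \<pi>"
  using assms(5)
proof (induction k arbitrary: \<pi>)
  case (Suc k)
  then show ?case unfolding belief_expectation_Suc
    using assms by (intro expect_next_mono bounded_measurable_belief_expectation) auto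
qed (use assms in simp)

lemma belief_expectation_const:
  assumes "\<pi> \<in> beliefs"
  shows "belief_expectation M P B \<mu> k (\<lambda>_. c) \<pi> = c"
  using assms
proof (induction k arbitrary: \<pi>)
  case (Suc k)
  then show ?case unfolding belief_expectation_Suc
    by (subst expect_next_cong[where g = "\<lambda>_. c"]) (auto simp: expect_next_const)
qed simp

lemma belief_expectation_add_mult:
  assumes "bounded_measurable f" "bounded_measurable g" "\<mu> \<in> policies M" and "\<pi> \<in> beliefs"
  shows "belief_expectation M P B \<mu> k (\<lambda>p. f p + c * g p) \<pi>
    = belief_expectation M P B \<mu> k f \<pi> + c * belief_expectation M P B \<mu> k g \<pi>"
  using assms(4)
proof (induction k arbitrary: \<pi>)
  case (Suc k)
  then show ?case unfolding belief_expectation_Suc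
    \<comment> \<open>The induction hypothesis holds on \<open>beliefs\<close> only, so it is used
      through congruence.\<close>
    using assms by (subst expect_next_cong[OF _ Suc.IH])
      (auto intro!: expect_next_add_mult bounded_measurable_belief_expectation)
qed simp

lemma belief_expectation_abs_le:
  assumes "bounded_measurable f" "\<mu> \<in> policies M" "\<pi> \<in> beliefs"
    and "\<And>p. p \<in> beliefs \<Longrightarrow> \<bar>f p\<bar> \<le> K"
  shows "\<bar>belief_expectation M P B \<mu> k f \<pi>\<bar> \<le> K"
proof -
  have "belief_expectation M P B \<mu> k f \<pi> \<le> belief_expectation M P B \<mu> k (\<lambda>_. K) \<pi>"
    using assms(4)
    by (intro belief_expectation_mono[OF assms(1) bounded_measurable_const assms(2) _ assms(3)])
      (simp add: abs_le_iff)
  moreover have "belief_expectation M P B \<mu> k (\<lambda>_. - K) \<pi> \<le> belief_expectation M P B \<mu> k f \<pi>"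
    using assms(4)
    by (intro belief_expectation_mono[OF bounded_measurable_const assms(1) assms(2) _ assms(3)])
      (simp add: abs_le_iff minus_le_iff)
  ultimately show ?thesis by (simp add: belief_expectation_const[OF assms(3)] abs_le_iff)
qed

end

section \<open>Dynamic programming\<close>

locale discounted_belief_mdp = belief_mdp M P B
  for M :: "real measure"
    and P :: "'u::finite \<Rightarrow> real ^ ('n::{finite,linorder}) ^ ('n::{finite,linorder})"
    and B :: "'u \<Rightarrow> 'n::{finite,linorder} \<Rightarrow> real \<Rightarrow> real" +
  fixes C :: "('n::{finite,linorder}) belief \<Rightarrow> 'u \<Rightarrow> real"
    and \<rho> :: real
  assumes cost: "\<And>u. bounded_measurable (\<lambda>\<pi>. C \<pi> u)"
    and discount: "0 \<le> \<rho>" "\<rho> < 1"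
begin

abbreviation Q :: "('n belief \<Rightarrow> real) \<Rightarrow> 'n belief \<Rightarrow> 'u \<Rightarrow> real" where
  "Q \<equiv> Q_function M P B C \<rho>"

lemma Q_eq: "Q V \<pi> u = C \<pi> u + \<rho> * expect_next u V \<pi>"
  by (simp add: Q_function_def expect_next_def)

definition bellman :: "('n belief \<Rightarrow> real) \<Rightarrow> 'n belief \<Rightarrow> real" where
  "bellman V \<pi> = Min (range (Q V \<pi>))"

lemma bounded_measurable_Q:
  "bounded_measurable V \<Longrightarrow> bounded_measurable (\<lambda>\<pi>. Q V \<pi> u)"
  unfolding Q_eq by (intro bounded_measurable_add_mult cost bounded_measurable_expect_next)

lemma Q_cong:
  assumes "\<pi> \<in> beliefs" "\<And>p. p \<in> beliefs \<Longrightarrow> V p = W p"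
  shows "Q V \<pi> u = Q W \<pi> u"
  unfolding Q_eq using expect_next_cong[OF assms] by simp

lemma bellman_le: "bellman V \<pi> \<le> Q V \<pi> u"
  unfolding bellman_def by (intro Min_le) auto

text \<open>An arbitrary choice among minimizing actions need not be measurable. Breaking ties by an
  enumeration of the actions makes every level set a finite combination of comparisons.\<close>

definition greedy :: "('n belief \<Rightarrow> real) \<Rightarrow> 'n belief \<Rightarrow> 'u" where
  "greedy V \<pi> = (ARG_MIN (to_nat_on UNIV) u. Q V \<pi> u = bellman V \<pi>)"

lemma Q_greedy: "Q V \<pi> (greedy V \<pi>) = bellman V \<pi>"
proof -
  have "bellman V \<pi> \<in> range (Q V \<pi>)" unfolding bellman_def by (intro Min_in) auto
  then obtain u where "bellman V \<pi> = Q V \<pi> u" by (rule rangeE)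
  then have "Q V \<pi> u = bellman V \<pi>" ..
  then show ?thesis unfolding greedy_def by (rule arg_min_natI)
qed

lemma bellman_measurable:
  assumes "bounded_measurable V"
  shows "bellman V \<in> borel_measurable (belief_events M)"
proof -
  have "(\<lambda>\<pi>. Min ((\<lambda>u. Q V \<pi> u) ` UNIV)) \<in> borel_measurable (belief_events M)"
    using bounded_measurable_Q[OF assms] unfolding bounded_measurable_def
    by (intro borel_measurable_Min) auto
  then show ?thesis by (simp add: bellman_def[abs_def])
qed

lemma greedy_eq_iff:
  "greedy V \<pi> = u \<longleftrightarrow> Q V \<pi> u = bellman V \<pi>
    \<and> (\<forall>v. to_nat_on UNIV v < to_nat_on UNIV u \<longrightarrow> Q V \<pi> v \<noteq> bellman V \<pi>)"
proof
  assume "greedy V \<pi> = u"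
  then show "Q V \<pi> u = bellman V \<pi>
      \<and> (\<forall>v. to_nat_on UNIV v < to_nat_on UNIV u \<longrightarrow> Q V \<pi> v \<noteq> bellman V \<pi>)"
    using Q_greedy[of V \<pi>] arg_min_nat_le[of "\<lambda>u. Q V \<pi> u = bellman V \<pi>" _ "to_nat_on UNIV"]
    unfolding greedy_def by (metis not_less)
next
  assume u: "Q V \<pi> u = bellman V \<pi>
      \<and> (\<forall>v. to_nat_on UNIV v < to_nat_on UNIV u \<longrightarrow> Q V \<pi> v \<noteq> bellman V \<pi>)"
  then have "to_nat_on UNIV (greedy V \<pi>) = to_nat_on UNIV u"
    using Q_greedy[of V \<pi>] arg_min_nat_le[of "\<lambda>u. Q V \<pi> u = bellman V \<pi>" u "to_nat_on UNIV"]
    unfolding greedy_def by (metis le_neq_implies_less)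
  then show "greedy V \<pi> = u"
    using inj_on_to_nat_on[of "UNIV :: 'u set"] by (auto dest: injD intro: countable_finite)
qed

lemma greedy_policy:
  assumes "bounded_measurable V"
  shows "greedy V \<in> policies M"
proof -
  have [measurable]: "(\<lambda>\<pi>. Q V \<pi> u) \<in> borel_measurable (belief_events M)" for u
    using bounded_measurable_Q[OF assms] by (simp add: bounded_measurable_def)
  note [measurable] = bellman_measurable[OF assms]
  have "Measurable.pred (belief_events M) (\<lambda>\<pi>. greedy V \<pi> = u)" for u
    unfolding greedy_eq_iff by measurable
  then have "greedy V -` {u} \<inter> space (belief_events M) \<in> sets (belief_events M)" for u
    by (simp add: pred_def vimage_def Int_def conj_commute)
  then show ?thesis
    unfolding policies_def
    by (subst measurable_count_space_eq2) auto
qed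

text \<open>The operator equals \<open>Q\<close> along the greedy policy, so boundedness and
  measurability follow from the closure under policies.\<close>

lemma bounded_measurable_bellman:
  assumes "bounded_measurable V"
  shows "bounded_measurable (bellman V)"
  using bounded_measurable_policy[where F = "\<lambda>u \<pi>. Q V \<pi> u",
      OF bounded_measurable_Q[OF assms] greedy_policy[OF assms]]
  by (simp add: Q_greedy)

section \<open>Contraction and convergence of value iteration\<close>

lemma bellman_abs_diff_le:
  assumes "bounded_measurable V" "bounded_measurable W" "\<pi> \<in> beliefs"
    and "\<And>p. p \<in> beliefs \<Longrightarrow> \<bar>V p - W p\<bar> \<le> e"
  shows "\<bar>bellman V \<pi> - bellman W \<pi>\<bar> \<le> \<rho> * e"
  unfolding bellman_def
proof (rule abs_Min_range_diff_le)
  fix u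
  have "\<bar>Q V \<pi> u - Q W \<pi> u\<bar> = \<rho> * \<bar>expect_next u V \<pi> - expect_next u W \<pi>\<bar>"
    unfolding Q_eq using discount(1) by (simp add: abs_mult right_diff_distrib[symmetric])
  also have "\<dots> \<le> \<rho> * e"
    using expect_next_abs_diff_le[OF assms] discount(1) by (intro mult_left_mono)
  finally show "\<bar>Q V \<pi> u - Q W \<pi> u\<bar> \<le> \<rho> * e" .
qed

definition iterate :: "nat \<Rightarrow> 'n belief \<Rightarrow> real" where
  "iterate n = (bellman ^^ n) (\<lambda>_. 0)"

lemma iterate_Suc: "iterate (Suc n) = bellman (iterate n)"
  by (simp add: iterate_def)

lemma bounded_measurable_iterate: "bounded_measurable (iterate n)"
proof (induction n)
  case 0
  show ?case using bounded_measurable_const[of 0] by (simp add: iterate_def)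
qed (simp add: iterate_Suc bounded_measurable_bellman)

lemma iterate_bounded: obtains K where "\<And>n p. p \<in> beliefs \<Longrightarrow> \<bar>iterate n p\<bar> \<le> K"
proof -
  obtain K where K: "\<And>p. p \<in> beliefs \<Longrightarrow> \<bar>iterate 1 p\<bar> \<le> K"
    using bounded_measurable_iterate[of 1] unfolding bounded_measurable_def by blast
  have K0: "0 \<le> K" using K[OF axis_in_beliefs] abs_ge_zero order_trans by blast
  \<comment> \<open>The bound is the solution L of K + \<rho> L = L, the sum of the geometric series
    of increments.\<close>
  have "\<bar>iterate n p\<bar> \<le> K / (1 - \<rho>)" if "p \<in> beliefs" for n p
    using that
  proof (induction n arbitrary: p)
    case 0
    show ?case using K0 discount by (simp add: iterate_def)
  next
    case (Suc n)
    have "\<bar>iterate (Suc n) p - iterate 1 p\<bar> \<le> \<rho> * (K / (1 - \<rho>))"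
      unfolding iterate_Suc One_nat_def
      using Suc by (intro bellman_abs_diff_le bounded_measurable_iterate) (auto simp: iterate_def)
    then have "\<bar>iterate (Suc n) p\<bar> \<le> K + \<rho> * (K / (1 - \<rho>))" using K[OF Suc.prems] by linarith
    also have "\<dots> = K / (1 - \<rho>)" using discount by (simp add: field_simps)
    finally show ?case .
  qed
  then show thesis by (rule that)
qed

text \<open>Contracting n times starts from the difference of \<open>iterate m\<close> and the zero
  function, which the uniform bound controls for all m.\<close>

lemma iterate_Cauchy_bound:
  obtains K where "\<And>n m p. p \<in> beliefs \<Longrightarrow> \<bar>iterate (n + m) p - iterate n p\<bar> \<le> \<rho> ^ n * K"
proof -
  obtain K where K: "\<And>n p. p \<in> beliefs \<Longrightarrow> \<bar>iterate n p\<bar> \<le> K" by (rule iterate_bounded) blast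
  have "\<bar>iterate (n + m) p - iterate n p\<bar> \<le> \<rho> ^ n * K" if "p \<in> beliefs" for n m p
    using that
  proof (induction n arbitrary: p)
    case 0
    then show ?case using K by (simp add: iterate_def)
  next
    case (Suc n)
    then have "\<bar>iterate (Suc (n + m)) p - iterate (Suc n) p\<bar> \<le> \<rho> * (\<rho> ^ n * K)"
      unfolding iterate_Suc by (intro bellman_abs_diff_le bounded_measurable_iterate)
    then show ?case by (simp add: mult.assoc)
  qed
  then show thesis by (rule that)
qed

text \<open>An explicit pointwise limit, so that weak inequalities between iterates, MLR
  monotonicity in particular, pass to it. It is meaningful on \<open>beliefs\<close> only.\<close>

definition optimal :: "'n belief \<Rightarrow> real" where
  "optimal \<pi> = lim (\<lambda>n. iterate n \<pi>)"

lemma power_discount_tendsto: "(\<lambda>n. \<rho> ^ n * K) \<longlonglongrightarrow> 0"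
  using tendsto_mult_left_zero[OF LIMSEQ_power_zero[of \<rho>]] discount by simp

lemma iterate_tendsto:
  assumes "\<pi> \<in> beliefs"
  shows "(\<lambda>n. iterate n \<pi>) \<longlonglongrightarrow> optimal \<pi>"
proof -
  obtain K where K: "\<And>n m p. p \<in> beliefs \<Longrightarrow> \<bar>iterate (n + m) p - iterate n p\<bar> \<le> \<rho> ^ n * K"
    by (rule iterate_Cauchy_bound) blast
  have "Cauchy (\<lambda>n. iterate n \<pi>)"
  proof (rule metric_CauchyI)
    fix e :: real assume "0 < e"
    then have "\<forall>\<^sub>F n in sequentially. \<rho> ^ n * K < e / 2"
      using power_discount_tendsto by (intro order_tendstoD) auto
    then obtain N where N: "\<rho> ^ N * K < e / 2" by (auto simp: eventually_sequentially)
    have "dist (iterate n \<pi>) (iterate N \<pi>) < e / 2" if "n \<ge> N" for n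
      using K[OF assms, of N "n - N"] N that by (simp add: dist_real_def)
    then show "\<exists>N. \<forall>m\<ge>N. \<forall>n\<ge>N. dist (iterate m \<pi>) (iterate n \<pi>) < e"
      by (intro exI[of _ N] allI impI) (rule dist_triangle_half_l[where y = "iterate N \<pi>"]; blast)
  qed
  then show ?thesis
    unfolding optimal_def by (simp add: Cauchy_convergent_iff convergent_LIMSEQ_iff)
qed

lemma bounded_measurable_optimal: "bounded_measurable optimal"
proof -
  obtain K where K: "\<And>n p. p \<in> beliefs \<Longrightarrow> \<bar>iterate n p\<bar> \<le> K" by (rule iterate_bounded) blast
  show ?thesis
  proof (rule bounded_measurableI)
    show "optimal \<in> borel_measurable (belief_events M)"
      unfolding optimal_def[abs_def] using bounded_measurable_iterate
      by (intro borel_measurable_lim_metric) (simp add: bounded_measurable_def)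
    fix p :: "'n belief" assume p: "p \<in> beliefs"
    show "\<bar>optimal p\<bar> \<le> K"
      by (rule LIMSEQ_le_const2[OF tendsto_rabs[OF iterate_tendsto[OF p]]]) (use K p in auto)
  qed
qed

lemma optimal_fixpoint:
  assumes "\<pi> \<in> beliefs"
  shows "bellman optimal \<pi> = optimal \<pi>"
proof -
  obtain K where K: "\<And>n m p. p \<in> beliefs \<Longrightarrow> \<bar>iterate (n + m) p - iterate n p\<bar> \<le> \<rho> ^ n * K"
    by (rule iterate_Cauchy_bound) blast
  \<comment> \<open>Letting m tend to infinity in the Cauchy bound gives a rate uniform in the
    belief, as the contraction estimate requires.\<close>
  have "\<bar>iterate n p - optimal p\<bar> \<le> \<rho> ^ n * K" if "p \<in> beliefs" for n p
  proof (rule LIMSEQ_le_const2)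
    show "(\<lambda>m. \<bar>iterate n p - iterate (m + n) p\<bar>) \<longlonglongrightarrow> \<bar>iterate n p - optimal p\<bar>"
      by (intro tendsto_intros LIMSEQ_ignore_initial_segment iterate_tendsto that)
    show "\<exists>N. \<forall>m\<ge>N. \<bar>iterate n p - iterate (m + n) p\<bar> \<le> \<rho> ^ n * K"
      using K[OF that, of n] by (simp add: add.commute[of _ n] abs_minus_commute)
  qed
  then have *: "\<bar>iterate (Suc n) \<pi> - bellman optimal \<pi>\<bar> \<le> \<rho> * (\<rho> ^ n * K)" for n
    unfolding iterate_Suc
    by (intro bellman_abs_diff_le bounded_measurable_iterate bounded_measurable_optimal assms)
  have "(\<lambda>n. iterate (Suc n) \<pi> - bellman optimal \<pi>) \<longlonglongrightarrow> 0"
  proof (rule Lim_null_comparison)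
    show "\<forall>\<^sub>F n in sequentially. norm (iterate (Suc n) \<pi> - bellman optimal \<pi>) \<le> \<rho> * (\<rho> ^ n * K)"
      using * by simp
    show "(\<lambda>n. \<rho> * (\<rho> ^ n * K)) \<longlonglongrightarrow> 0"
      using tendsto_mult_left[OF power_discount_tendsto, of \<rho>] by simp
  qed
  then have "(\<lambda>n. iterate (Suc n) \<pi>) \<longlonglongrightarrow> bellman optimal \<pi>" by (simp add: LIM_zero_iff)
  moreover have "(\<lambda>n. iterate (Suc n) \<pi>) \<longlonglongrightarrow> optimal \<pi>"
    using iterate_tendsto[OF assms] by (rule LIMSEQ_Suc)
  ultimately show ?thesis by (rule LIMSEQ_unique)
qed

section \<open>Verification against the costs of policies\<close>

lemma discounted_cost_sums:
  assumes \<mu>: "\<mu> \<in> policies M" and \<pi>: "\<pi> \<in> beliefs"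
  shows "(\<lambda>k. \<rho> ^ k * belief_expectation M P B \<mu> k (\<lambda>p. C p (\<mu> p)) \<pi>)
    sums discounted_cost M P B C \<rho> \<mu> \<pi>"
proof -
  have bm: "bounded_measurable (\<lambda>p. C p (\<mu> p))"
    using bounded_measurable_policy[OF cost \<mu>] .
  then obtain K where K: "\<And>p. p \<in> beliefs \<Longrightarrow> \<bar>C p (\<mu> p)\<bar> \<le> K"
    unfolding bounded_measurable_def by blast
  have "summable (\<lambda>k. \<rho> ^ k * belief_expectation M P B \<mu> k (\<lambda>p. C p (\<mu> p)) \<pi>)"
  proof (rule summable_comparison_test')
    show "summable (\<lambda>k. \<rho> ^ k * K)"
      using discount by (intro summable_mult2 summable_geometric) auto
    show "norm (\<rho> ^ k * belief_expectation M P B \<mu> k (\<lambda>p. C p (\<mu> p)) \<pi>) \<le> \<rho> ^ k * K" for k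
      using belief_expectation_abs_le[OF bm \<mu> \<pi> K] discount(1)
      by (auto simp: abs_mult intro!: mult_left_mono)
  qed
  then show ?thesis unfolding discounted_cost_def by (rule summable_sums)
qed

text \<open>The summand is the stage cost for which \<open>W\<close> is exactly the discounted cost
  of \<mu>. Comparing \<open>W\<close> with an actual cost thus becomes a termwise comparison of two
  series.\<close>

lemma telescoping_sums:
  assumes \<mu>: "\<mu> \<in> policies M" and \<pi>: "\<pi> \<in> beliefs" and W: "bounded_measurable W"
  shows "(\<lambda>k. \<rho> ^ k * belief_expectation M P B \<mu> k (\<lambda>p. W p + - \<rho> * expect_next (\<mu> p) W p) \<pi>)
    sums W \<pi>"
proof -
  define E where "E k = \<rho> ^ k * belief_expectation M P B \<mu> k W \<pi>" for k
  obtain K where K: "\<And>p. p \<in> beliefs \<Longrightarrow> \<bar>W p\<bar> \<le> K"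
    using W unfolding bounded_measurable_def by blast
  have "\<rho> ^ k * belief_expectation M P B \<mu> k (\<lambda>p. W p + - \<rho> * expect_next (\<mu> p) W p) \<pi>
      = E k - E (Suc k)" for k
    unfolding E_def belief_expectation_Suc_right
    by (subst belief_expectation_add_mult[OF W
          bounded_measurable_policy[OF bounded_measurable_expect_next[OF W] \<mu>] \<mu> \<pi>])
      (simp add: algebra_simps)
  moreover have "E \<longlonglongrightarrow> 0"
  proof (rule Lim_null_comparison[OF _ power_discount_tendsto])
    show "\<forall>\<^sub>F k in sequentially. norm (E k) \<le> \<rho> ^ k * K"
      using belief_expectation_abs_le[OF W \<mu> \<pi> K] discount(1)
      by (auto simp: E_def abs_mult intro!: mult_left_mono always_eventually)
  qed
  then have "(\<lambda>k. E k - E (Suc k)) sums (E 0 - 0)" by (rule telescope_sums')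
  ultimately show ?thesis by (simp add: E_def)
qed

lemma le_discounted_cost:
  assumes \<mu>: "\<mu> \<in> policies M" and \<pi>: "\<pi> \<in> beliefs" and W: "bounded_measurable W"
    and le: "\<And>p. p \<in> beliefs \<Longrightarrow> W p \<le> Q W p (\<mu> p)"
  shows "W \<pi> \<le> discounted_cost M P B C \<rho> \<mu> \<pi>"
proof (rule sums_le[OF _ telescoping_sums[OF \<mu> \<pi> W] discounted_cost_sums[OF \<mu> \<pi>]])
  have "W p + - \<rho> * expect_next (\<mu> p) W p \<le> C p (\<mu> p)" if "p \<in> beliefs" for p
    using le[OF that] by (simp add: Q_eq)
  then show "\<rho> ^ k * belief_expectation M P B \<mu> k (\<lambda>p. W p + - \<rho> * expect_next (\<mu> p) W p) \<pi>
      \<le> \<rho> ^ k * belief_expectation M P B \<mu> k (\<lambda>p. C p (\<mu> p)) \<pi>" for k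
    using discount(1)
    by (intro mult_left_mono belief_expectation_mono[OF _ _ \<mu> _ \<pi>]
        bounded_measurable_add_mult[OF W] bounded_measurable_policy[OF cost \<mu>]
        bounded_measurable_policy[OF bounded_measurable_expect_next[OF W] \<mu>]) auto
qed

lemma discounted_cost_le:
  assumes \<mu>: "\<mu> \<in> policies M" and \<pi>: "\<pi> \<in> beliefs" and W: "bounded_measurable W"
    and le: "\<And>p. p \<in> beliefs \<Longrightarrow> Q W p (\<mu> p) \<le> W p"
  shows "discounted_cost M P B C \<rho> \<mu> \<pi> \<le> W \<pi>"
proof (rule sums_le[OF _ discounted_cost_sums[OF \<mu> \<pi>] telescoping_sums[OF \<mu> \<pi> W]])
  have "C p (\<mu> p) \<le> W p + - \<rho> * expect_next (\<mu> p) W p" if "p \<in> beliefs" for p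
    using le[OF that] by (simp add: Q_eq)
  then show "\<rho> ^ k * belief_expectation M P B \<mu> k (\<lambda>p. C p (\<mu> p)) \<pi>
      \<le> \<rho> ^ k * belief_expectation M P B \<mu> k (\<lambda>p. W p + - \<rho> * expect_next (\<mu> p) W p) \<pi>" for k
    using discount(1)
    by (intro mult_left_mono belief_expectation_mono[OF _ _ \<mu> _ \<pi>]
        bounded_measurable_add_mult[OF W] bounded_measurable_policy[OF cost \<mu>]
        bounded_measurable_policy[OF bounded_measurable_expect_next[OF W] \<mu>]) auto
qed

lemma value_function_eq_optimal:
  assumes \<pi>: "\<pi> \<in> beliefs"
  shows "value_function M P B C \<rho> \<pi> = optimal \<pi>"
proof -
  note bm = bounded_measurable_optimal
  have lower: "optimal \<pi> \<le> discounted_cost M P B C \<rho> \<mu> \<pi>" if "\<mu> \<in> policies M" for \<mu>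
    using le_discounted_cost[OF that \<pi> bm] optimal_fixpoint bellman_le by metis
  have "discounted_cost M P B C \<rho> (greedy optimal) \<pi> = optimal \<pi>"
    using discounted_cost_le[OF greedy_policy[OF bm] \<pi> bm] lower[OF greedy_policy[OF bm]]
    by (simp add: Q_greedy optimal_fixpoint order_antisym)
  then show ?thesis
    unfolding value_function_def using lower greedy_policy[OF bm]
    \<comment> \<open>The greedy policy attains the infimum, so it is a minimum.\<close>
    by (intro cInf_eq_minimum) (auto simp: image_iff intro!: bexI[of _ "greedy optimal"])
qed

lemma bellman_equation_value_function: "bellman_equation M P B C \<rho> (value_function M P B C \<rho>)"
  unfolding bellman_equation_def
proof
  fix \<pi> :: "'n belief" assume \<pi>: "\<pi> \<in> beliefs"
  have "Q (value_function M P B C \<rho>) \<pi> = Q optimal \<pi>"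
    by (intro ext Q_cong \<pi> value_function_eq_optimal)
  then show "value_function M P B C \<rho> \<pi> = Min (range (Q (value_function M P B C \<rho>) \<pi>))"
    using value_function_eq_optimal[OF \<pi>] optimal_fixpoint[OF \<pi>] by (simp add: bellman_def)
qed

section \<open>Monotonicity of \<open>Q\<close> and of the limit\<close>

lemma Q_mlr_decreasing:
  assumes "\<And>u. mlr_decreasing (\<lambda>\<pi>. C \<pi> u)"
    and "\<And>u. TP2_on UNIV (space M) (B u)" and "\<And>u. TP2_on UNIV UNIV (\<lambda>i j. P u $ i $ j)"
    and "bounded_measurable V" "mlr_decreasing V"
  shows "mlr_decreasing (\<lambda>\<pi>. Q V \<pi> u)"
  unfolding Q_eq
  by (intro mlr_decreasing_add_mult expect_next_mlr_decreasing assms discount)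

lemma optimal_mlr_decreasing:
  assumes "\<And>u. mlr_decreasing (\<lambda>\<pi>. C \<pi> u)"
    and "\<And>u. TP2_on UNIV (space M) (B u)" and "\<And>u. TP2_on UNIV UNIV (\<lambda>i j. P u $ i $ j)"
  shows "mlr_decreasing optimal"
proof -
  have iter: "mlr_decreasing (iterate n)" for n
  proof (induction n)
    case 0
    show ?case by (simp add: iterate_def mlr_decreasing_def)
  next
    case (Suc n)
    then show ?case unfolding iterate_Suc bellman_def[abs_def]
      by (intro mlr_decreasing_Min Q_mlr_decreasing assms bounded_measurable_iterate)
  qed
  show ?thesis
    unfolding mlr_decreasing_def
  proof (intro ballI impI)
    fix p q :: "'n belief" assume pq: "p \<in> beliefs" "q \<in> beliefs" "mlr_ge p q"
    then show "optimal p \<le> optimal q"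
      using iter unfolding mlr_decreasing_def
      by (intro LIMSEQ_le[OF iterate_tendsto iterate_tendsto]) auto
  qed
qed

end

theorem theorem5p2p1:
  fixes M :: "real measure"
    and P :: "'u::finite \<Rightarrow> real ^ ('n::{finite,linorder}) ^ ('n::{finite,linorder})"
    and B :: "'u \<Rightarrow> 'n \<Rightarrow> real \<Rightarrow> real"
    and C :: "'n belief \<Rightarrow> 'u \<Rightarrow> real"
    and \<rho> :: real
  assumes "observation_space M"
    and "\<And>u. stochastic_matrix (P u)"
    and "\<And>u. observation_kernel M (B u)"
    and "\<And>u. (\<lambda>\<pi>. C \<pi> u) \<in> borel_measurable (belief_events M)"
    and "0 \<le> \<rho>" and "\<rho> < 1"
    and C: "\<And>u. fosd_decreasing (\<lambda>\<pi>. C \<pi> u)"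
    and F1: "\<And>u. TP2_on UNIV (space M) (B u)"
    and F2: "\<And>u. TP2_on UNIV UNIV (\<lambda>i j. P u $ i $ j)"
  shows "bellman_equation M P B C \<rho> (value_function M P B C \<rho>)
    \<and> (\<forall>u. mlr_decreasing (\<lambda>\<pi>. Q_function M P B C \<rho> (value_function M P B C \<rho>) \<pi> u))
    \<and> mlr_decreasing (value_function M P B C \<rho>)"
proof -
  interpret belief_mdp M P B
    using assms(1-3) by unfold_locales
  have "bounded_measurable (\<lambda>\<pi>. C \<pi> u)" for u
    using assms(4) fosd_decreasing_bounded[OF C] by (simp add: bounded_measurable_def)
  then interpret discounted_belief_mdp M P B C \<rho>
    using assms(5,6) by unfold_locales
  have C_mlr: "mlr_decreasing (\<lambda>\<pi>. C \<pi> u)" for u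
    using C[of u] mlr_ge_imp_fosd_ge unfolding mlr_decreasing_def fosd_decreasing_def by blast
  note optimal = optimal_mlr_decreasing[OF C_mlr F1 F2]
  have "mlr_decreasing (value_function M P B C \<rho>)"
    by (rule mlr_decreasing_cong[THEN iffD2, OF value_function_eq_optimal optimal])
  \<comment> \<open>Monotonicity is transferred from \<open>optimal\<close>, since from a belief
    \<open>Q\<close> depends on its function argument only through values on
    \<open>beliefs\<close>.\<close>
  moreover have "mlr_decreasing (\<lambda>\<pi>. Q (value_function M P B C \<rho>) \<pi> u)" for u
    by (rule mlr_decreasing_cong[THEN iffD2, OF Q_cong[OF _ value_function_eq_optimal]
          Q_mlr_decreasing[OF C_mlr F1 F2 bounded_measurable_optimal optimal]])
  ultimately show ?thesis using bellman_equation_value_function by blast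
qed

end
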